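(* Let $A\in\mathbb{R}^{m\times n}$, $b\in\mathbb{R}^m$, $\tau>0$, $f(x)=\frac12\lVert Ax-b\rVert_2^2$, and let $L$ be the Lipschitz constant of $\nabla f$. If $A$ satisfies the restricted isometry property of order $2s$ with constant $\delta_{2s}\in(0,1)$, $\delta=1-\delta_{2s}$, and the solution $x^*$ of the LASSO problem $\min\{\lVert Ax-b\rVert_2:\lVert x\rVert_1\le\tau\}$ is $s$-sparse, then the restarted accelerated proximal gradient algorithm NESTA-LASSO-K (with prox-center updates every $K$ steps) is almost always locally linearly convergent for any integer $K>\sqrt{L/\delta}$.
   Context: Sparsity: a vector is $s$-sparse if it has exactly $s$ nonzero entries ($s\ge1$). $\lVert x\rVert_0$ is the number of nonzero entries of $x$. For nonzero $x$, $I_x$ is its support and $\overline{x}$ is the vector of its nonzero entries. $A_I$ is the submatrix of $A$ consisting of the columns indexed by $I$, and $I^c$ is the complement of $I$ in $\{1,\dots,n\}$. Restricted isometry property (RIP) of order $2s$ with constant $\delta_{2s}\in(0,1)$: $(1-\delta_{2s})\lVert x\rVert_2^2\le\lVert Ax\rVert_2^2\le(1+\delta_{2s})\lVert x\rVert_2^2$ whenever $\lVert x\rVert_0\le 2s$. Projection: $\operatorname{proj}_1(v,\tau)=\operatorname{argmin}\{\lVert v-x\rVert_2:\lVert x\rVert_1\le\tau\}$. Nesterov's accelerated proximal gradient method for $f$ on $\{\lVert x\rVert_1\le\tau\}$ with prox-center $c$: put $x_0=c$ and for $k=0,1,2,\dots$ $$y_k=\operatorname{proj}_1\Big(x_k-\tfrac1L\nabla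 f(x_k),\tau\Big),\quad z_k=\operatorname{proj}_1\Big(c-\tfrac1L\sum_{i=0}^k\tfrac{i+1}{2}\nabla f(x_i),\tau\Big),\quad x_{k+1}=\tfrac{2}{k+3}z_k+\tfrac{k+1}{k+3}y_k,$$ where $\nabla f(x)=A^{\top}(Ax-b)$. NESTA-LASSO-K: given an initial prox-center $p_0$ and $K$, for $j=0,1,2,\dots$ run Nesterov's accelerated proximal gradient method for $f$ on $\{\lVert x\rVert_1\le\tau\}$ with prox-center $c=p_j$ up to its $K$-th iterate $y_K$, and set the new prox-center $p_{j+1}=\operatorname{proj}_1(y_K-\frac1L\nabla f(y_K),\tau)$ (stopping tests are disregarded). Locally linearly convergent: there are $r>0$ and $\rho\in(0,1)$ such that, whenever $\lVert p_0-x^*\rVert_2<r$, one has $\lVert p_{j+1}-x^*\rVert_2\le\rho\lVert p_j-x^*\rVert_2$ for all $j\ge0$. Almost always: a point $x^*$ with support $I$ is a solution of the LASSO problem iff for some $\gamma\ge0$ one has $A_I^{\top}(b-A_I\overline{x}^* )=\gamma\,\operatorname{sgn}(\overline{x}^* )$ and $\lVert A_{I^c}^{\top}(b-A_I\overline{x}^* )\rVert_\infty\le\gamma$; the parameters $\gamma$ and $\tau$ are in one-to-one correspondence. For fixed $m,n$ and $I\subseteq\{1,\dots,n\}$ with $|I|=s\le m$, the LASSO problems with $A\in\mathbb{R}^{m\times n}$ satisfying the RIP of order $2s$ and with solution $x^*$ of support $I$ are identified with the tuples $(A_I,A_{I^c},b,\gamma)\in\mathbb{R}^{m\times s}\times\mathbb{R}^{m\times(n-s)}\times\mathbb{R}^m\times[0,\infty)$.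 A property holds almost always if, for every such $m,n,I$, the set of those tuples for which it fails has Lebesgue measure zero. *)

theory Defs
  imports "HOL-Analysis.Analysis"
begin

definition support :: "real^'n \<Rightarrow> 'n set" where
  "support x = {i. x $ i \<noteq> 0}"

definition norm0 :: "real^'n \<Rightarrow> nat" where
  "norm0 x = card (support x)"

definition norm1 :: "real^'n \<Rightarrow> real" where
  "norm1 x = (\<Sum>i\<in>UNIV. \<bar>x $ i\<bar>)"

definition RIP :: "real^'n^'m \<Rightarrow> nat \<Rightarrow> real \<Rightarrow> bool" where
  "RIP A k \<delta> \<longleftrightarrow> 0 < \<delta> \<and> \<delta> < 1 \<and>
     (\<forall>x. norm0 x \<le> k \<longrightarrow>
        (1 - \<delta>) * (norm x)\<^sup>2 \<le> (norm (A *v x))\<^sup>2 \<and>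
        (norm (A *v x))\<^sup>2 \<le> (1 + \<delta>) * (norm x)\<^sup>2)"

definition proj1 :: "real^'n \<Rightarrow> real \<Rightarrow> real^'n" where
  "proj1 v \<tau> = closest_point {x. norm1 x \<le> \<tau>} v"

definition lasso_obj :: "real^'n^'m \<Rightarrow> real^'m \<Rightarrow> real^'n \<Rightarrow> real" where
  "lasso_obj A b x = (norm (A *v x - b))\<^sup>2 / 2"

definition lasso_grad :: "real^'n^'m \<Rightarrow> real^'m \<Rightarrow> real^'n \<Rightarrow> real^'n" where
  "lasso_grad A b x = transpose A *v (A *v x - b)"

lemma lasso_grad_is_gradient:
  "(lasso_obj A b has_derivative (\<lambda>h. lasso_grad A b x \<bullet> h)) (at x)"
proof -
  have 1: "lasso_obj A b = (\<lambda>x. ((A *v x - b) \<bullet> (A *v x - b)) / 2)"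
    by (simp add: lasso_obj_def power2_norm_eq_inner fun_eq_iff)
  have bl: "bounded_linear ((*v) A)"
    by (rule matrix_vector_mul_bounded_linear)
  have 2: "((\<lambda>x. A *v x - b) has_derivative (\<lambda>h. A *v h)) (at x)"
    using has_derivative_diff[OF bounded_linear_imp_has_derivative[OF bl] has_derivative_const]
    by simp
  have "lasso_grad A b x \<bullet> h = (A *v x - b) \<bullet> (A *v h)" for h
    by (simp add: lasso_grad_def dot_lmul_matrix flip: vector_transpose_matrix)
  then show ?thesis unfolding 1
    by (auto intro!: has_derivative_eq_rhs[OF has_derivative_divide'[OF has_derivative_inner[OF 2 2]]]
        simp: inner_commute)
qed

text \<open>The Lipschitz constant of a map is its least one.\<close>

definition lipschitz_const :: "('a::metric_space \<Rightarrow> 'b::metric_space) \<Rightarrow> real" where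
  "lipschitz_const g = Inf {C. C-lipschitz_on UNIV g}"

definition lasso_solution :: "real^'n^'m \<Rightarrow> real^'m \<Rightarrow> real \<Rightarrow> real^'n \<Rightarrow> bool" where
  "lasso_solution A b \<tau> x \<longleftrightarrow>
     is_arg_min (\<lambda>x. norm (A *v x - b)) (\<lambda>x. norm1 x \<le> \<tau>) x"

text \<open>The iterates \<open>x\<^sub>k\<close>, \<open>y\<^sub>k\<close>, \<open>z\<^sub>k\<close> of Nesterov's accelerated proximal gradient
  method with gradient map \<open>g\<close>, prox-center \<open>c\<close> and step \<open>1 / L\<close> on the 1-norm ball of
  radius \<open>\<tau>\<close>.  The prox-center need not lie in the ball.\<close>

function
  apg_x :: "(real^'n \<Rightarrow> real^'n) \<Rightarrow> real \<Rightarrow> real \<Rightarrow> real^'n \<Rightarrow> nat \<Rightarrow> real^'n" and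
  apg_y :: "(real^'n \<Rightarrow> real^'n) \<Rightarrow> real \<Rightarrow> real \<Rightarrow> real^'n \<Rightarrow> nat \<Rightarrow> real^'n" and
  apg_z :: "(real^'n \<Rightarrow> real^'n) \<Rightarrow> real \<Rightarrow> real \<Rightarrow> real^'n \<Rightarrow> nat \<Rightarrow> real^'n"
where
  "apg_x g L \<tau> c 0 = c"
| "apg_x g L \<tau> c (Suc k) =
     (2 / (real k + 3)) *\<^sub>R apg_z g L \<tau> c k + ((real k + 1) / (real k + 3)) *\<^sub>R apg_y g L \<tau> c k"
| "apg_y g L \<tau> c k =
     proj1 (apg_x g L \<tau> c k - (1 / L) *\<^sub>R g (apg_x g L \<tau> c k)) \<tau>"
| "apg_z g L \<tau> c k =
     proj1 (c - (1 / L) *\<^sub>R (\<Sum>i\<le>k. ((real i + 1) / 2) *\<^sub>R g (apg_x g L \<tau> c i))) \<tau>"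
  by pat_completeness auto
termination
  by (relation "Wellfounded.measure (\<lambda>s. case s of
        Inl (g, L, \<tau>, c, k) \<Rightarrow> 2 * k
      | Inr (Inl (g, L, \<tau>, c, k)) \<Rightarrow> 2 * k + 1
      | Inr (Inr (g, L, \<tau>, c, k)) \<Rightarrow> 2 * k + 1)") auto

declare apg_y.simps [simp del] apg_z.simps [simp del]

text \<open>The successive prox-centers \<open>p\<^sub>j\<close>.\<close>

primrec nesta_lasso ::
  "real^'n^'m \<Rightarrow> real^'m \<Rightarrow> real \<Rightarrow> real \<Rightarrow> nat \<Rightarrow> real^'n \<Rightarrow> nat \<Rightarrow> real^'n"
where
  "nesta_lasso A b L \<tau> K p0 0 = p0"
| "nesta_lasso A b L \<tau> K p0 (Suc j) =
     (let g = lasso_grad A b;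
          y = apg_y g L \<tau> (nesta_lasso A b L \<tau> K p0 j) K
      in proj1 (y - (1 / L) *\<^sub>R g y) \<tau>)"

definition locally_linearly_convergent ::
  "('a \<Rightarrow> nat \<Rightarrow> 'a) \<Rightarrow> 'a::real_normed_vector \<Rightarrow> bool"
where
  "locally_linearly_convergent p xs \<longleftrightarrow>
     (\<exists>r > 0. \<exists>\<rho>. 0 < \<rho> \<and> \<rho> < 1 \<and>
       (\<forall>p0. norm (p0 - xs) < r \<longrightarrow>
          (\<forall>j. norm (p p0 (Suc j) - xs) \<le> \<rho> * norm (p p0 j - xs))))"

text \<open>Since \<open>x\<close> vanishes off its support \<open>I\<close>, the vector \<open>A *v x\<close> is the product of \<open>A\<^sub>I\<close> with
  the vector of nonzero entries of \<open>x\<close>; the two conjuncts are the coordinates in \<open>I\<close> and in its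
  complement of the optimality conditions with multiplier \<open>\<gamma>\<close>.\<close>

definition lasso_multiplier :: "real^'n^'m \<Rightarrow> real^'m \<Rightarrow> real \<Rightarrow> real^'n \<Rightarrow> bool" where
  "lasso_multiplier A b \<gamma> x \<longleftrightarrow>
     (\<forall>i \<in> support x. (transpose A *v (b - A *v x)) $ i = \<gamma> * sgn (x $ i)) \<and>
     (\<forall>i \<in> - support x. \<bar>(transpose A *v (b - A *v x)) $ i\<bar> \<le> \<gamma>)"

text \<open>A property \<open>P A b \<tau> xs\<close> of LASSO problems with solution \<open>xs\<close>.  The columns of \<open>A\<close> indexed by
  \<open>I\<close> and by its complement together are the matrix \<open>A\<close> itself, so the parameter tuples
  form a subset of the Euclidean space of all \<open>(A, b, \<gamma>)\<close>.  The problem behind a tuple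
  is recovered through the multiplier: the set below contains a tuple as soon as \<open>P\<close> fails for
  one of the problems having \<open>\<gamma>\<close> as multiplier.\<close>

definition almost_always ::
  "nat \<Rightarrow> (real^'n^'m \<Rightarrow> real^'m \<Rightarrow> real \<Rightarrow> real^'n \<Rightarrow> bool) \<Rightarrow> bool"
where
  "almost_always s P \<longleftrightarrow>
     (\<forall>I. card I = s \<and> s \<le> CARD('m) \<longrightarrow>
        {(A, b, \<gamma>). 0 \<le> \<gamma> \<and> (\<exists>\<delta>. RIP A (2 * s) \<delta>) \<and>
           (\<exists>\<tau> xs. 0 < \<tau> \<and> lasso_solution A b \<tau> xs \<and> support xs = I \<and>
              lasso_multiplier A b \<gamma> xs \<and> \<not> P A b \<tau> xs)}
        \<in> null_sets lebesgue)"

end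

theory Submission
  imports Defs
begin

text \<open>Nesterov's estimate-sequence inequality, kept with its distance term, gives
  \<open>norm (z\<^sub>k - x\<^sup>*) \<le> norm (c - x\<^sup>*)\<close> for the prox-center \<open>c\<close>; gradient steps are nonexpansive, so
  the same bound holds for \<open>x\<^sub>k\<close> and \<open>y\<^sub>k\<close>.  Under strict complementarity the projection of every
  point near \<open>x\<^sup>* - (1 / L) *\<^sub>R g x\<^sup>*\<close> (\<open>g\<close> the gradient) is supported in the support of \<open>x\<^sup>*\<close>.  Hence \<open>y\<^sub>K - x\<^sup>*\<close> is
  sparse, and by the restricted isometry property the gradient step that follows \<open>y\<^sub>K\<close> contracts
  by the factor \<open>sqrt (1 - (1 - \<delta>\<^sub>2\<^sub>s) / L)\<close>.  The data violating strict complementarity lie in the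
  hyperplane \<open>\<gamma> = 0\<close> or have \<open>s + 1\<close> columns with prescribed correlation \<open>\<plusminus>\<gamma>\<close> with the nonzero
  residual, which confines them to finitely many differentiable images of a hyperplane.\<close>

section \<open>Projection onto the 1-norm ball\<close>

lemma convex_norm1_ball: "convex {x :: real^'n. norm1 x \<le> \<tau>}"
proof (rule convexI)
  fix x y :: "real^'n" and u v :: real
  assume xy: "x \<in> {x. norm1 x \<le> \<tau>}" "y \<in> {x. norm1 x \<le> \<tau>}"
    and uv: "0 \<le> u" "0 \<le> v" "u + v = 1"
  have "norm1 (u *\<^sub>R x + v *\<^sub>R y) \<le> (\<Sum>i\<in>UNIV. u * \<bar>x $ i\<bar> + v * \<bar>y $ i\<bar>)"
    unfolding norm1_def using uv
    by (intro sum_mono) (auto intro!: order_trans[OF abs_triangle_ineq] simp: abs_mult)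
  also have "\<dots> = u * norm1 x + v * norm1 y"
    by (simp add: norm1_def sum.distrib sum_distrib_left)
  also have "\<dots> \<le> u * \<tau> + v * \<tau>"
    using xy uv by (intro add_mono mult_left_mono) auto
  also have "\<dots> = \<tau>"
    using uv(3) by (simp flip: distrib_right)
  finally show "u *\<^sub>R x + v *\<^sub>R y \<in> {x. norm1 x \<le> \<tau>}" by simp
qed

lemma closed_norm1_ball: "closed {x :: real^'n. norm1 x \<le> \<tau>}"
  unfolding norm1_def by (intro closed_Collect_le continuous_intros)

text \<open>Witnesses that the ball is nonempty, as the closest-point facts require.\<close>

lemma zero_in_norm1_ball: "0 \<le> \<tau> \<Longrightarrow> 0 \<in> {x :: real^'n. norm1 x \<le> \<tau>}"
  by (simp add: norm1_def)

lemma norm1_proj1_le: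
  fixes v :: "real^'n"
  assumes "0 \<le> \<tau>"
  shows "norm1 (proj1 v \<tau>) \<le> \<tau>"
  using closest_point_in_set[OF closed_norm1_ball, of \<tau> v] zero_in_norm1_ball[OF assms]
  unfolding proj1_def by blast

lemma proj1_dot:
  fixes v q :: "real^'n"
  assumes "norm1 q \<le> \<tau>"
  shows "(v - proj1 v \<tau>) \<bullet> (q - proj1 v \<tau>) \<le> 0"
  unfolding proj1_def
  by (rule closest_point_dot[OF convex_norm1_ball closed_norm1_ball]) (use assms in simp)

lemma proj1_nonexpansive:
  fixes v w :: "real^'n"
  assumes "0 \<le> \<tau>"
  shows "norm (proj1 v \<tau> - proj1 w \<tau>) \<le> norm (v - w)"
  using closest_point_lipschitz[OF convex_norm1_ball closed_norm1_ball, of \<tau> v w]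
    zero_in_norm1_ball[OF assms]
  unfolding proj1_def dist_norm by blast

lemma isCont_proj1:
  fixes v :: "real^'n"
  assumes "0 \<le> \<tau>"
  shows "isCont (\<lambda>v. proj1 v \<tau>) v"
  unfolding proj1_def
  using continuous_at_closest_point[OF convex_norm1_ball closed_norm1_ball, of \<tau> v]
    zero_in_norm1_ball[OF assms] by blast

text \<open>Up to a constant and scaling, projecting minimizes the strongly convex
  \<open>s \<bullet> x + L / 2 * (norm (x - c))\<^sup>2\<close> over the ball, so a competitor
  \<open>q\<close> loses at least the squared distance term. Both projections of the method are
  instances.\<close>

lemma proj1_three_point:
  fixes c s q :: "real^'n"
  assumes "norm1 q \<le> \<tau>" "0 < L"
  defines "p \<equiv> proj1 (c - (1 / L) *\<^sub>R s) \<tau>"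
  shows "s \<bullet> p + L / 2 * (norm (p - c))\<^sup>2 + L / 2 * (norm (q - p))\<^sup>2
    \<le> s \<bullet> q + L / 2 * (norm (q - c))\<^sup>2"
proof -
  have "L * ((c - (1 / L) *\<^sub>R s - p) \<bullet> (q - p)) \<le> L * 0"
    unfolding p_def by (intro mult_left_mono proj1_dot) (use assms in auto)
  then have "L * ((c - p) \<bullet> (q - p)) \<le> s \<bullet> (q - p)"
    using assms(2) by (simp add: inner_diff_left algebra_simps)
  moreover have "(norm (p - c))\<^sup>2 + (norm (q - p))\<^sup>2 - (norm (q - c))\<^sup>2
      = 2 * ((c - p) \<bullet> (q - p))"
    by (simp add: power2_norm_eq_inner inner_diff_left inner_diff_right inner_commute)
  then have "L / 2 * ((norm (p - c))\<^sup>2 + (norm (q - p))\<^sup>2 - (norm (q - c))\<^sup>2)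
      = L / 2 * (2 * ((c - p) \<bullet> (q - p)))"
    by (rule arg_cong)
  then have "L / 2 * (norm (p - c))\<^sup>2 + L / 2 * (norm (q - p))\<^sup>2 - L / 2 * (norm (q - c))\<^sup>2
      = L * ((c - p) \<bullet> (q - p))"
    by (simp add: right_diff_distrib distrib_left)
  ultimately show ?thesis by (simp add: inner_diff_right)
qed

text \<open>Shifting the mass of the coordinate \<open>i\<close> to the coordinate \<open>i\<^sub>0\<close> does not increase the
  1-norm, so optimality of the projection forces a coordinate with smaller residual to vanish.\<close>

lemma proj1_eq_zero:
  fixes v :: "real^'n"
  assumes "0 \<le> \<tau>" "\<bar>\<sigma>\<bar> = 1"
    and less: "\<bar>(v - proj1 v \<tau>) $ i\<bar> < \<sigma> * (v - proj1 v \<tau>) $ i0"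
  shows "proj1 v \<tau> $ i = 0"
proof (rule ccontr)
  define p where "p = proj1 v \<tau>"
  define w where "w = v - p"
  assume "proj1 v \<tau> $ i \<noteq> 0"
  then have nz: "p $ i \<noteq> 0" by (simp add: p_def)
  have lw: "\<bar>w $ i\<bar> < \<sigma> * w $ i0" using less by (simp add: w_def p_def)
  have ne: "i0 \<noteq> i"
  proof
    assume "i0 = i"
    moreover have "\<sigma> * w $ i0 \<le> \<bar>w $ i0\<bar>"
      using assms(2) abs_ge_self[of "\<sigma> * w $ i0"] by (simp add: abs_mult)
    ultimately show False using lw by simp
  qed
  define q where "q = p + axis i (- (p $ i)) + axis i0 (\<sigma> * \<bar>p $ i\<bar>)"
  \<comment> \<open>The two corrections cancel when summed over all coordinates.\<close>
  have qi: "\<bar>q $ j\<bar> \<le> \<bar>p $ j\<bar> + (if j = i then - \<bar>p $ i\<bar> else 0) + (if j = i0 then \<bar>p $ i\<bar> else 0)"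
    for j
    using ne assms(2) abs_triangle_ineq[of "p $ i0" "\<sigma> * \<bar>p $ i\<bar>"]
    by (auto simp: q_def axis_def abs_mult)
  have "norm1 q \<le> norm1 p"
    unfolding norm1_def
    by (rule order_trans[OF sum_mono[OF qi]]) (simp add: sum.distrib)
  then have "norm1 q \<le> \<tau>" using norm1_proj1_le[OF assms(1), of v] by (simp add: p_def)
  then have "w \<bullet> (q - p) \<le> 0" unfolding w_def p_def by (rule proj1_dot)
  moreover have "w \<bullet> (q - p) = - (p $ i * w $ i) + \<sigma> * \<bar>p $ i\<bar> * w $ i0"
    by (simp add: q_def inner_add_right inner_axis)
  moreover have "p $ i * w $ i \<le> \<bar>p $ i\<bar> * \<bar>w $ i\<bar>"
    using abs_ge_self[of "p $ i * w $ i"] by (simp add: abs_mult)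
  moreover have "\<bar>p $ i\<bar> * \<bar>w $ i\<bar> < \<bar>p $ i\<bar> * (\<sigma> * w $ i0)"
    using nz lw by simp
  ultimately show False by (simp add: mult_ac)
qed

section \<open>The accelerated method stays close to a solution\<close>

text \<open>The weights \<open>(i + 1) / 2\<close> of the linearizations sum to the factor of
  \<open>f (y\<^sub>k)\<close>. The right-hand side, as a function of \<open>z\<close>, is minimized
  over the ball by \<open>z\<^sub>k\<close>, and its strong convexity supplies the distance term on
  the left.\<close>

lemma apg_estimate:
  fixes f :: "real^'n \<Rightarrow> real" and g :: "real^'n \<Rightarrow> real^'n"
  assumes \<tau>: "0 \<le> \<tau>" and L: "0 < L"
    and lower: "\<And>x y. f x + g x \<bullet> (y - x) \<le> f y"
    and upper: "\<And>x y. f y \<le> f x + g x \<bullet> (y - x) + L / 2 * (norm (y - x))\<^sup>2"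
    and z: "norm1 z \<le> \<tau>"
  shows "(real k + 1) * (real k + 2) / 4 * f (apg_y g L \<tau> c k)
      + L / 2 * (norm (z - apg_z g L \<tau> c k))\<^sup>2
    \<le> L / 2 * (norm (z - c))\<^sup>2
      + (\<Sum>i\<le>k. (real i + 1) / 2 * (f (apg_x g L \<tau> c i) + g (apg_x g L \<tau> c i) \<bullet> (z - apg_x g L \<tau> c i)))"
proof -
  define X where "X = apg_x g L \<tau> c"
  define Y where "Y = apg_y g L \<tau> c"
  define Z where "Z = apg_z g L \<tau> c"
  define l where "l i z = f (X i) + g (X i) \<bullet> (z - X i)" for i z
  define \<psi> where "\<psi> k z = L / 2 * (norm (z - c))\<^sup>2 + (\<Sum>i\<le>k. (real i + 1) / 2 * l i z)" for k z
  have Yle: "norm1 (Y k) \<le> \<tau>" and Zle: "norm1 (Z k) \<le> \<tau>" for k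
    unfolding Y_def Z_def apg_y.simps apg_z.simps by (intro norm1_proj1_le \<tau>)+
  have Ymin: "f (Y k) \<le> l k q + L / 2 * (norm (q - X k))\<^sup>2" if "norm1 q \<le> \<tau>" for k q
  proof -
    have "g (X k) \<bullet> Y k + L / 2 * (norm (Y k - X k))\<^sup>2 + L / 2 * (norm (q - Y k))\<^sup>2
        \<le> g (X k) \<bullet> q + L / 2 * (norm (q - X k))\<^sup>2"
      using proj1_three_point[OF that L, of "g (X k)" "X k"] by (simp add: Y_def X_def apg_y.simps)
    moreover have "0 \<le> L / 2 * (norm (q - Y k))\<^sup>2" using L by simp
    ultimately show ?thesis
      using upper[of "Y k" "X k"] by (simp add: l_def inner_diff_right)
  qed
  \<comment> \<open>Collecting the slopes into \<open>s\<close> makes \<open>\<psi> k\<close> a prox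
    term plus a linear form plus a constant, which is the setting of
    \<open>proj1_three_point\<close>.\<close>
  have Zmin: "\<psi> k (Z k) + L / 2 * (norm (q - Z k))\<^sup>2 \<le> \<psi> k q" if "norm1 q \<le> \<tau>" for k q
  proof -
    define s where "s = (\<Sum>i\<le>k. ((real i + 1) / 2) *\<^sub>R g (X i))"
    have \<psi>: "\<psi> k z = L / 2 * (norm (z - c))\<^sup>2 + s \<bullet> z
        + (\<Sum>i\<le>k. (real i + 1) / 2 * (f (X i) - g (X i) \<bullet> X i))" for z
      by (simp add: \<psi>_def l_def s_def inner_sum_left inner_diff_right algebra_simps
          flip: sum.distrib)
    show ?thesis
      using proj1_three_point[OF that L, of s c]
      unfolding \<psi> by (simp add: Z_def s_def X_def apg_z.simps)
  qed
  \<comment> \<open>\<open>z\<close> stays general in the induction because the hypothesis for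
    \<open>k\<close> is applied at \<open>Z (Suc k)\<close>.\<close>
  have main: "(real k + 1) * (real k + 2) / 4 * f (Y k) + L / 2 * (norm (z - Z k))\<^sup>2 \<le> \<psi> k z"
    if "norm1 z \<le> \<tau>" for k z
    using that
  proof (induction k arbitrary: z)
    case 0
    have X0: "X 0 = c" by (simp add: X_def)
    \<comment> \<open>The first weight is \<open>1 / 2\<close>, so half of the prox term in
      \<open>\<psi> 0\<close> suffices.\<close>
    have "1 / 2 * f (Y 0) \<le> 1 / 2 * (l 0 (Z 0) + L / 2 * (norm (Z 0 - c))\<^sup>2)"
      using Ymin[OF Zle, of 0 0] by (simp add: X0)
    also have "\<dots> \<le> \<psi> 0 (Z 0)"
      using L by (simp add: \<psi>_def)
    finally show ?case using Zmin[OF 0, of 0] by simp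
  next
    case (Suc k)
    \<comment> \<open>\<open>a\<close> is the weight of the new linearization; \<open>A\<close> and
      \<open>B\<close> are the sums of the weights up to \<open>k\<close> and up to
      \<open>Suc k\<close>.\<close>
    define a A B where "a = (real k + 2) / 2" and "A = (real k + 1) * (real k + 2) / 4"
      and "B = (real k + 2) * (real k + 3) / 4"
    have pos: "0 < a" "0 < A" "0 < B"
      unfolding a_def A_def B_def by (auto intro!: divide_pos_pos mult_pos_pos)
    have AB: "A + a = B"
      by (simp add: a_def A_def B_def field_simps)
    \<comment> \<open>This limit on the growth of the weights makes the quadratic error at
      \<open>u\<close>, scaled by \<open>B\<close>, affordable.\<close>
    have aB: "a\<^sup>2 \<le> B"
      by (auto simp: a_def B_def power2_eq_square field_simps)
    \<comment> \<open>\<open>u\<close> is \<open>X (Suc k)\<close> with \<open>Z k\<close> replaced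
      by \<open>Z (Suc k)\<close>, so the two differ only by a multiple of the move of
      \<open>Z\<close>.\<close>
    define u where "u = (A / B) *\<^sub>R Y k + (a / B) *\<^sub>R Z (Suc k)"
    have XS: "X (Suc k) = (A / B) *\<^sub>R Y k + (a / B) *\<^sub>R Z k"
    proof -
      have B: "B = a * ((real k + 3) / 2)" and A: "A = a * ((real k + 1) / 2)"
        by (simp_all add: a_def B_def A_def field_simps)
      have "a / B = 2 / (real k + 3)" "A / B = (real k + 1) / (real k + 3)"
        unfolding A B using pos(1) by (simp_all add: divide_simps)
      then show ?thesis by (simp add: X_def Y_def Z_def)
    qed
    have "u \<in> {x. norm1 x \<le> \<tau>}"
      unfolding u_def using pos AB
      by (intro convexD[OF convex_norm1_ball]) (auto simp: Yle Zle simp flip: add_divide_distrib)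
    then have u: "norm1 u \<le> \<tau>" by simp
    have "u - X (Suc k) = (a / B) *\<^sub>R (Z (Suc k) - Z k)"
      by (simp add: u_def XS algebra_simps)
    then have "(norm (u - X (Suc k)))\<^sup>2 = (a / B)\<^sup>2 * (norm (Z (Suc k) - Z k))\<^sup>2"
      by (simp only: norm_scaleR power_mult_distrib power2_abs)
    then have "B * (L / 2 * (norm (u - X (Suc k)))\<^sup>2)
        = (a\<^sup>2 / B) * (L / 2 * (norm (Z (Suc k) - Z k))\<^sup>2)"
      using pos by (simp add: power2_eq_square mult_ac)
    also have "\<dots> \<le> 1 * (L / 2 * (norm (Z (Suc k) - Z k))\<^sup>2)"
      using aB pos L by (intro mult_right_mono) auto
    finally have sq: "B * (L / 2 * (norm (u - X (Suc k)))\<^sup>2)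
        \<le> L / 2 * (norm (Z (Suc k) - Z k))\<^sup>2" by simp
    have lu: "B * l (Suc k) u = A * l (Suc k) (Y k) + a * l (Suc k) (Z (Suc k))"
    proof -
      have "B *\<^sub>R u = A *\<^sub>R Y k + a *\<^sub>R Z (Suc k)"
        using pos by (simp add: u_def scaleR_add_right)
      then have "B * (g (X (Suc k)) \<bullet> u) = A * (g (X (Suc k)) \<bullet> Y k) + a * (g (X (Suc k)) \<bullet> Z (Suc k))"
        by (metis inner_add_right inner_scaleR_right)
      then show ?thesis by (simp add: l_def inner_diff_right algebra_simps flip: AB)
    qed
    have "B * f (Y (Suc k)) \<le> B * (l (Suc k) u + L / 2 * (norm (u - X (Suc k)))\<^sup>2)"
      using Ymin[OF u, of "Suc k"] pos by simp
    also have "\<dots> \<le> A * l (Suc k) (Y k) + a * l (Suc k) (Z (Suc k))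
        + L / 2 * (norm (Z (Suc k) - Z k))\<^sup>2"
      using sq lu by (simp add: distrib_left)
    also have "A * l (Suc k) (Y k) \<le> A * f (Y k)"
      using lower[of "X (Suc k)" "Y k"] pos by (simp add: l_def)
    \<comment> \<open>The distance term of the induction hypothesis at \<open>Z (Suc k)\<close> pays
      for the move away from \<open>Z k\<close>.\<close>
    also have "A * f (Y k) + a * l (Suc k) (Z (Suc k)) + L / 2 * (norm (Z (Suc k) - Z k))\<^sup>2
        \<le> \<psi> k (Z (Suc k)) + a * l (Suc k) (Z (Suc k))"
      using Suc.IH[OF Zle, of "Suc k"] by (simp add: A_def)
    also have "\<dots> = \<psi> (Suc k) (Z (Suc k))"
      by (simp add: \<psi>_def a_def)
    finally have "B * f (Y (Suc k)) \<le> \<psi> (Suc k) (Z (Suc k))" by simp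
    then show ?case using Zmin[OF Suc.prems, of "Suc k"] by (simp add: B_def add_ac)
  qed
  show ?thesis
    using main[OF z, of k] by (simp add: Y_def Z_def X_def \<psi>_def l_def)
qed


text \<open>Evaluated at \<open>z\<close>, the linearizations lie below \<open>f z\<close>, hence
  below \<open>f (y\<^sub>k)\<close>. The weights have the same sum on both sides of the estimate,
  so the function values drop out and only distances remain.\<close>

lemma norm_apg_z_diff_le:
  fixes f :: "real^'n \<Rightarrow> real" and g :: "real^'n \<Rightarrow> real^'n"
  assumes \<tau>: "0 \<le> \<tau>" and L: "0 < L"
    and lower: "\<And>x y. f x + g x \<bullet> (y - x) \<le> f y"
    and upper: "\<And>x y. f y \<le> f x + g x \<bullet> (y - x) + L / 2 * (norm (y - x))\<^sup>2"
    and z: "norm1 z \<le> \<tau>" and minimal: "\<And>y. norm1 y \<le> \<tau> \<Longrightarrow> f z \<le> f y"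
  shows "norm (apg_z g L \<tau> c k - z) \<le> norm (c - z)"
proof -
  define X where "X = apg_x g L \<tau> c"
  have weights: "(\<Sum>i\<le>k. (real i + 1) / 2) = (real k + 1) * (real k + 2) / 4"
    by (induction k) (auto simp: field_simps)
  have "(\<Sum>i\<le>k. (real i + 1) / 2 * (f (X i) + g (X i) \<bullet> (z - X i)))
      \<le> (\<Sum>i\<le>k. (real i + 1) / 2 * f z)"
    by (intro sum_mono mult_left_mono lower) auto
  also have "\<dots> = (real k + 1) * (real k + 2) / 4 * f z"
    by (simp only: weights flip: sum_distrib_right)
  also have "\<dots> \<le> (real k + 1) * (real k + 2) / 4 * f (apg_y g L \<tau> c k)"
    by (intro mult_left_mono minimal) (auto simp: apg_y.simps norm1_proj1_le \<tau>)
  finally have "L / 2 * (norm (z - apg_z g L \<tau> c k))\<^sup>2 \<le> L / 2 * (norm (z - c))\<^sup>2"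
    using apg_estimate[OF \<tau> L lower upper z, of k c] unfolding X_def by linarith
  then show ?thesis
    using L by (simp add: norm_minus_commute)
qed

text \<open>The three-point inequality with \<open>c = q = z\<close> shows that a step from
  \<open>z\<close> to \<open>y\<close> lowers \<open>f\<close> by at least
  \<open>L / 2 * (norm (z - y))\<^sup>2\<close>, so minimality forces \<open>y = z\<close>.\<close>

lemma proj1_gradient_step_minimizer:
  fixes f :: "real^'n \<Rightarrow> real" and g :: "real^'n \<Rightarrow> real^'n"
  assumes \<tau>: "0 \<le> \<tau>" and L: "0 < L"
    and upper: "\<And>x y. f y \<le> f x + g x \<bullet> (y - x) + L / 2 * (norm (y - x))\<^sup>2"
    and z: "norm1 z \<le> \<tau>" and minimal: "\<And>y. norm1 y \<le> \<tau> \<Longrightarrow> f z \<le> f y"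
  shows "proj1 (z - (1 / L) *\<^sub>R g z) \<tau> = z"
proof -
  define y where "y = proj1 (z - (1 / L) *\<^sub>R g z) \<tau>"
  have "f z \<le> f y"
    unfolding y_def by (intro minimal norm1_proj1_le \<tau>)
  then have "L / 2 * (norm (z - y))\<^sup>2 \<le> 0"
    using upper[of y z] proj1_three_point[OF z L, of "g z" z]
    by (simp add: y_def inner_diff_right)
  then show ?thesis
    using L by (simp add: y_def mult_le_0_iff)
qed

text \<open>The ball around \<open>z\<close> of radius \<open>norm (c - z)\<close> is convex and
  contains \<open>z\<^sub>k\<close> and, through the induction hypothesis for
  \<open>x\<^sub>k\<close>, also \<open>y\<^sub>k\<close>; the next iterate is a convex combination
  of these.\<close>

lemma norm_apg_x_diff_le:
  fixes f :: "real^'n \<Rightarrow> real" and g :: "real^'n \<Rightarrow> real^'n"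
  assumes \<tau>: "0 \<le> \<tau>" and L: "0 < L"
    and lower: "\<And>x y. f x + g x \<bullet> (y - x) \<le> f y"
    and upper: "\<And>x y. f y \<le> f x + g x \<bullet> (y - x) + L / 2 * (norm (y - x))\<^sup>2"
    and step: "\<And>x y. norm ((x - (1 / L) *\<^sub>R g x) - (y - (1 / L) *\<^sub>R g y)) \<le> norm (x - y)"
    and z: "norm1 z \<le> \<tau>" and minimal: "\<And>y. norm1 y \<le> \<tau> \<Longrightarrow> f z \<le> f y"
  shows "norm (apg_x g L \<tau> c k - z) \<le> norm (c - z)"
proof (induction k)
  case 0
  then show ?case by simp
next
  case (Suc k)
  define \<alpha> \<beta> where "\<alpha> = 2 / (real k + 3)" and "\<beta> = (real k + 1) / (real k + 3)"
  have \<alpha>\<beta>: "0 \<le> \<alpha>" "0 \<le> \<beta>" "\<alpha> + \<beta> = 1"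
    unfolding \<alpha>_def \<beta>_def by (auto simp flip: add_divide_distrib)
  \<comment> \<open>Writing \<open>z\<close> as its own projected gradient step makes the difference
    one of two such steps.\<close>
  have "norm (apg_y g L \<tau> c k - z)
      = norm (apg_y g L \<tau> c k - proj1 (z - (1 / L) *\<^sub>R g z) \<tau>)"
    by (simp only: proj1_gradient_step_minimizer[OF \<tau> L upper z minimal])
  also have "\<dots> \<le> norm (apg_x g L \<tau> c k - z)"
    unfolding apg_y.simps by (rule order_trans[OF proj1_nonexpansive[OF \<tau>] step])
  also have "\<dots> \<le> norm (c - z)"
    by (rule Suc.IH)
  finally have y: "norm (apg_y g L \<tau> c k - z) \<le> norm (c - z)" .
  have "apg_x g L \<tau> c (Suc k) = \<alpha> *\<^sub>R apg_z g L \<tau> c k + \<beta> *\<^sub>R apg_y g L \<tau> c k"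
    by (simp add: \<alpha>_def \<beta>_def)
  moreover have "\<alpha> *\<^sub>R (apg_z g L \<tau> c k - z) + \<beta> *\<^sub>R (apg_y g L \<tau> c k - z)
      = \<alpha> *\<^sub>R apg_z g L \<tau> c k + \<beta> *\<^sub>R apg_y g L \<tau> c k - (\<alpha> + \<beta>) *\<^sub>R z"
    by (simp add: algebra_simps)
  ultimately have "apg_x g L \<tau> c (Suc k) - z
      = \<alpha> *\<^sub>R (apg_z g L \<tau> c k - z) + \<beta> *\<^sub>R (apg_y g L \<tau> c k - z)"
    using \<alpha>\<beta>(3) by simp
  then have "norm (apg_x g L \<tau> c (Suc k) - z)
      \<le> norm (\<alpha> *\<^sub>R (apg_z g L \<tau> c k - z)) + norm (\<beta> *\<^sub>R (apg_y g L \<tau> c k - z))"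
    by (simp only: norm_triangle_ineq)
  also have "\<dots> = \<alpha> * norm (apg_z g L \<tau> c k - z) + \<beta> * norm (apg_y g L \<tau> c k - z)"
    using \<alpha>\<beta> by simp
  also have "\<dots> \<le> \<alpha> * norm (c - z) + \<beta> * norm (c - z)"
    using \<alpha>\<beta> y norm_apg_z_diff_le[OF \<tau> L lower upper z minimal, of c k]
    by (intro add_mono mult_left_mono)
  also have "\<dots> = norm (c - z)"
    using \<alpha>\<beta>(3) by (simp flip: distrib_right)
  finally show ?case .
qed

section \<open>The least squares objective\<close>

lemma inner_transpose_mult: "(transpose A *v u) \<bullet> x = u \<bullet> (A *v x)"
  for A :: "real^'n^'m"
  by (simp add: dot_lmul_matrix)

lemma lasso_grad_diff: "lasso_grad A b x - lasso_grad A b y = transpose A *v (A *v (x - y))"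
  unfolding lasso_grad_def matrix_vector_mult_diff_distrib[symmetric]
  by (simp add: matrix_vector_mult_diff_distrib del: transpose_matrix_vector)

text \<open>Exact because the objective is quadratic. Dropping the last square gives convexity,
  bounding it through \<open>L\<close> gives the upper model.\<close>

lemma lasso_obj_expand:
  "lasso_obj A b y = lasso_obj A b x + lasso_grad A b x \<bullet> (y - x) + (norm (A *v (y - x)))\<^sup>2 / 2"
proof -
  define u w where "u = A *v x - b" and "w = A *v (y - x)"
  have "A *v y - b = u + w"
    by (simp add: u_def w_def matrix_vector_mult_diff_distrib)
  then show ?thesis
    unfolding lasso_obj_def lasso_grad_def inner_transpose_mult u_def[symmetric] w_def[symmetric]
    by (simp add: power2_norm_eq_inner inner_add_left inner_add_right inner_commute field_simps)
qed

text \<open>Gradient differences are the Gram matrix applied to differences of points, so every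
  Lipschitz constant bounds the ratio of norms, and then so does their infimum.\<close>

lemma norm_gram_le:
  fixes A :: "real^'n^'m"
  shows "norm (transpose A *v (A *v x)) \<le> lipschitz_const (lasso_grad A b) * norm x"
proof (cases "x = 0")
  case False
  let ?S = "{C. C-lipschitz_on UNIV (lasso_grad A b)}"
  have "norm (transpose A *v (A *v x)) / norm x \<le> C" if "C \<in> ?S" for C
    using lipschitz_onD[of C UNIV "lasso_grad A b" x 0] that False
    by (simp add: dist_norm lasso_grad_diff field_simps del: transpose_matrix_vector)
  \<comment> \<open>The infimum is meaningful only for a nonempty set; a nonnegative operator bound
    of the Gram matrix is a member.\<close>
  moreover have "?S \<noteq> {}"
  proof -
    obtain B where "\<And>x. norm ((transpose A ** A) *v x) \<le> norm x * B" "0 \<le> B"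
      using bounded_linear.nonneg_bounded[OF matrix_vector_mul_bounded_linear[of "transpose A ** A"]]
      by blast
    then have "B \<in> ?S"
      by (auto intro!: lipschitz_onI simp: dist_norm lasso_grad_diff matrix_vector_mul_assoc mult.commute
          simp del: transpose_matrix_vector)
    then show ?thesis by blast
  qed
  ultimately have "norm (transpose A *v (A *v x)) / norm x \<le> Inf ?S"
    by (intro cInf_greatest)
  then show ?thesis
    using False by (simp add: lipschitz_const_def field_simps)
qed simp

lemma norm_mult_sq_le:
  fixes A :: "real^'n^'m"
  assumes "L = lipschitz_const (lasso_grad A b)"
  shows "(norm (A *v x))\<^sup>2 \<le> L * (norm x)\<^sup>2"
proof -
  have "(norm (A *v x))\<^sup>2 = (transpose A *v (A *v x)) \<bullet> x"
    unfolding inner_transpose_mult power2_norm_eq_inner ..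
  also have "\<dots> \<le> norm (transpose A *v (A *v x)) * norm x"
    by (rule norm_cauchy_schwarz)
  also have "\<dots> \<le> (L * norm x) * norm x"
    using norm_gram_le[of A x b] assms by (intro mult_right_mono) auto
  finally show ?thesis by (simp add: power2_eq_square)
qed

text \<open>Cocoercivity of the gradient. With \<open>w = A *v x\<close> and
  \<open>u = transpose A *v w\<close>, Cauchy-Schwarz bounds
  \<open>(norm u)\<^sup>2 = w \<bullet> (A *v u)\<close> by \<open>sqrt L * norm w * norm u\<close>,
  and a factor \<open>norm u\<close> cancels.\<close>

lemma norm_gram_sq_le:
  fixes A :: "real^'n^'m"
  assumes L: "L = lipschitz_const (lasso_grad A b)" "0 < L"
  shows "(norm (transpose A *v (A *v x)))\<^sup>2 \<le> L * (norm (A *v x))\<^sup>2"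
proof (cases "transpose A *v (A *v x) = 0")
  case True
  then show ?thesis using L(2) by simp
next
  case False
  define w u where "w = A *v x" and "u = transpose A *v w"
  have nz: "norm u \<noteq> 0" using False by (simp add: u_def w_def)
  have "(norm u)\<^sup>2 = w \<bullet> (A *v u)"
    by (simp add: power2_norm_eq_inner u_def dot_lmul_matrix)
  also have "\<dots> \<le> norm w * norm (A *v u)"
    by (rule norm_cauchy_schwarz)
  finally have "((norm u)\<^sup>2)\<^sup>2 \<le> (norm w * norm (A *v u))\<^sup>2"
    by (intro power_mono) auto
  also have "\<dots> = (norm w)\<^sup>2 * (norm (A *v u))\<^sup>2"
    by (simp add: power_mult_distrib)
  also have "\<dots> \<le> (norm w)\<^sup>2 * (L * (norm u)\<^sup>2)"
    by (intro mult_left_mono norm_mult_sq_le[OF L(1)]) auto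
  finally have "(norm u)\<^sup>2 * (norm u)\<^sup>2 \<le> (L * (norm w)\<^sup>2) * (norm u)\<^sup>2"
    by (simp add: power2_eq_square mult_ac)
  then have "(norm u)\<^sup>2 \<le> L * (norm w)\<^sup>2"
    by (rule mult_right_le_imp_le) (use nz in simp)
  then show ?thesis by (simp add: u_def w_def)
qed

text \<open>Expanding the square, the cross term subtracts \<open>2 / L\<close> times
  \<open>(norm (A *v (x - y)))\<^sup>2\<close> and cocoercivity returns at most half of that. The
  bound gives nonexpansiveness in general and contraction on sparse differences.\<close>

lemma norm_gradient_step_sq_le:
  fixes A :: "real^'n^'m"
  assumes L: "L = lipschitz_const (lasso_grad A b)" "0 < L"
  shows "(norm ((x - (1 / L) *\<^sub>R lasso_grad A b x) - (y - (1 / L) *\<^sub>R lasso_grad A b y)))\<^sup>2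
    \<le> (norm (x - y))\<^sup>2 - (norm (A *v (x - y)))\<^sup>2 / L"
proof -
  define e where "e = x - y"
  define h where "h = transpose A *v (A *v e)"
  have "(x - (1 / L) *\<^sub>R lasso_grad A b x) - (y - (1 / L) *\<^sub>R lasso_grad A b y) = e - (1 / L) *\<^sub>R h"
    unfolding h_def e_def lasso_grad_diff[of A b x y, symmetric] by (simp add: algebra_simps)
  also have "(norm (e - (1 / L) *\<^sub>R h))\<^sup>2 = (norm e)\<^sup>2 - 2 / L * (h \<bullet> e) + (norm h)\<^sup>2 / L\<^sup>2"
    unfolding power2_norm_eq_inner inner_diff_left inner_diff_right
    by (simp add: inner_commute power2_eq_square field_simps)
  also have "h \<bullet> e = (norm (A *v e))\<^sup>2"
    unfolding h_def inner_transpose_mult power2_norm_eq_inner ..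
  also have "(norm h)\<^sup>2 / L\<^sup>2 \<le> (L * (norm (A *v e))\<^sup>2) / L\<^sup>2"
    unfolding h_def by (intro divide_right_mono norm_gram_sq_le[OF L]) auto
  finally show ?thesis
    using L(2) by (simp add: e_def power2_eq_square field_simps)
qed

section \<open>Local linear convergence under strict complementarity\<close>

text \<open>At the gradient step from \<open>xs\<close>, the residual of the projection is the
  correlation vector divided by \<open>L\<close>. Its strict gap between \<open>i0\<close> and the
  coordinates off the support persists nearby by continuity, and \<open>proj1_eq_zero\<close>
  applies.\<close>

lemma eventually_support_proj1_subset:
  fixes A :: "real^'n^'m"
  assumes \<tau>: "0 \<le> \<tau>" and L: "0 < L"
    and fixed: "proj1 (xs - (1 / L) *\<^sub>R lasso_grad A b xs) \<tau> = xs"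
    and i0: "i0 \<in> support xs"
    and multiplier: "lasso_multiplier A b \<gamma> xs"
    and strict: "\<And>i. i \<notin> support xs \<Longrightarrow> \<bar>(transpose A *v (b - A *v xs)) $ i\<bar> < \<gamma>"
  shows "\<forall>\<^sub>F v in nhds (xs - (1 / L) *\<^sub>R lasso_grad A b xs). support (proj1 v \<tau>) \<subseteq> support xs"
proof -
  define vs where "vs = xs - (1 / L) *\<^sub>R lasso_grad A b xs"
  \<comment> \<open>This sign turns the multiplier equation at \<open>i0\<close> into
    \<open>\<sigma> * r $ i0 = \<gamma>\<close>.\<close>
  define \<sigma> where "\<sigma> = sgn (xs $ i0)"
  define r where "r = transpose A *v (b - A *v xs)"
  have \<sigma>: "\<bar>\<sigma>\<bar> = 1" "\<sigma> * \<sigma> = 1"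
    using i0 by (auto simp: \<sigma>_def support_def sgn_if)
  have "lasso_grad A b xs = - r"
    unfolding r_def lasso_grad_def
    by (metis matrix_vector_mult_diff_distrib minus_diff_eq)
  then have residual: "vs - proj1 vs \<tau> = (1 / L) *\<^sub>R r"
    using fixed by (simp add: vs_def)
  have r0: "\<sigma> * r $ i0 = \<gamma>"
    using multiplier i0 \<sigma>(2) by (simp add: lasso_multiplier_def r_def \<sigma>_def mult_ac)
  have "\<forall>\<^sub>F v in nhds vs. \<bar>(v - proj1 v \<tau>) $ i\<bar> < \<sigma> * (v - proj1 v \<tau>) $ i0"
    if "i \<notin> support xs" for i
  proof -
    have "((\<lambda>v. proj1 v \<tau>) \<longlongrightarrow> proj1 vs \<tau>) (nhds vs)"
      using isCont_proj1[OF \<tau>, of vs]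
      unfolding isCont_def tendsto_at_iff_tendsto_nhds[where g = "\<lambda>v. proj1 v \<tau>"] .
    then have cont: "((\<lambda>v. v - proj1 v \<tau>) \<longlongrightarrow> vs - proj1 vs \<tau>) (nhds vs)"
      by (intro tendsto_diff filterlim_ident)
    have "((\<lambda>v. \<sigma> * (v - proj1 v \<tau>) $ i0 - \<bar>(v - proj1 v \<tau>) $ i\<bar>)
        \<longlongrightarrow> \<sigma> * (vs - proj1 vs \<tau>) $ i0 - \<bar>(vs - proj1 vs \<tau>) $ i\<bar>) (nhds vs)"
      by (intro tendsto_intros cont)
    moreover have "0 < \<sigma> * (vs - proj1 vs \<tau>) $ i0 - \<bar>(vs - proj1 vs \<tau>) $ i\<bar>"
    proof -
      have "\<sigma> * (vs - proj1 vs \<tau>) $ i0 = \<gamma> / L"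
        using r0 unfolding residual by simp
      moreover have "\<bar>(vs - proj1 vs \<tau>) $ i\<bar> = \<bar>r $ i\<bar> / L"
        using L unfolding residual by simp
      moreover have "\<bar>r $ i\<bar> / L < \<gamma> / L"
        unfolding r_def by (rule divide_strict_right_mono[OF strict[OF that] L])
      ultimately show ?thesis by simp
    qed
    ultimately have "\<forall>\<^sub>F v in nhds vs. 0 < \<sigma> * (v - proj1 v \<tau>) $ i0 - \<bar>(v - proj1 v \<tau>) $ i\<bar>"
      by (rule order_tendstoD(1))
    then show ?thesis by simp
  qed
  then have "\<forall>\<^sub>F v in nhds vs. \<forall>i\<in>- support xs. \<bar>(v - proj1 v \<tau>) $ i\<bar> < \<sigma> * (v - proj1 v \<tau>) $ i0"
    by (intro eventually_ball_finite) auto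
  then show ?thesis
    unfolding vs_def[symmetric]
  proof (rule eventually_mono)
    fix v
    assume "\<forall>i\<in>- support xs. \<bar>(v - proj1 v \<tau>) $ i\<bar> < \<sigma> * (v - proj1 v \<tau>) $ i0"
    then have "proj1 v \<tau> $ i = 0" if "i \<notin> support xs" for i
      using that proj1_eq_zero[OF \<tau> \<sigma>(1), of v i i0] by blast
    then show "support (proj1 v \<tau>) \<subseteq> support xs"
      unfolding support_def[of "proj1 v \<tau>"] by blast
  qed
qed

text \<open>Here \<open>\<delta>\<close> is the RIP constant itself, so \<open>1 - \<delta>\<close>
  is the quantity called \<open>\<delta>\<close> in the theorem. The radius comes from the
  neighbourhood in which projections stay within the support of \<open>xs\<close>.\<close>

lemma nesta_lasso_locally_linearly_convergent:
  fixes A :: "real^'n^'m"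
  assumes \<tau>: "0 < \<tau>" and sol: "lasso_solution A b \<tau> xs"
    and RIP: "RIP A (2 * s) \<delta>" and s: "card (support xs) = s" "1 \<le> s"
    and multiplier: "lasso_multiplier A b \<gamma> xs"
    and strict: "\<And>i. i \<notin> support xs \<Longrightarrow> \<bar>(transpose A *v (b - A *v xs)) $ i\<bar> < \<gamma>"
    and L: "L = lipschitz_const (lasso_grad A b)"
  shows "locally_linearly_convergent (nesta_lasso A b L \<tau> K) xs"
proof -
  let ?g = "lasso_grad A b"
  have \<tau>0: "0 \<le> \<tau>" using \<tau> by simp
  have \<delta>: "0 < \<delta>" "\<delta> < 1"
    using RIP by (auto simp: RIP_def)
  have RIP_le: "(1 - \<delta>) * (norm x)\<^sup>2 \<le> (norm (A *v x))\<^sup>2" if "norm0 x \<le> 2 * s" for x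
    using RIP that by (auto simp: RIP_def)
  obtain i0 where i0: "i0 \<in> support xs"
    using s by (metis all_not_in_conv card.empty not_one_le_zero)
  \<comment> \<open>On a unit coordinate vector the lower RIP bound meets the upper bound by
    \<open>L\<close>. This makes \<open>L\<close> positive and keeps the square root below
    real.\<close>
  have \<delta>L: "1 - \<delta> \<le> L"
  proof -
    have "support (axis i0 1 :: real^'n) = {i0}"
      by (auto simp: support_def axis_def)
    then have "norm0 (axis i0 1 :: real^'n) \<le> 2 * s"
      using s by (simp add: norm0_def)
    from RIP_le[OF this] norm_mult_sq_le[OF L, of "axis i0 1"] show ?thesis
      by simp
  qed
  with \<delta> have L0: "0 < L" by simp
  have lower: "lasso_obj A b x + ?g x \<bullet> (y - x) \<le> lasso_obj A b y" for x y
    using lasso_obj_expand[of A b y x] by simp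
  have upper: "lasso_obj A b y \<le> lasso_obj A b x + ?g x \<bullet> (y - x) + L / 2 * (norm (y - x))\<^sup>2" for x y
    using lasso_obj_expand[of A b y x] norm_mult_sq_le[OF L, of "y - x"] by simp
  have step: "norm ((x - (1 / L) *\<^sub>R ?g x) - (y - (1 / L) *\<^sub>R ?g y)) \<le> norm (x - y)" for x y
  proof (rule power2_le_imp_le)
    have "0 \<le> (norm (A *v (x - y)))\<^sup>2 / L" using L0 by simp
    then show "(norm ((x - (1 / L) *\<^sub>R ?g x) - (y - (1 / L) *\<^sub>R ?g y)))\<^sup>2 \<le> (norm (x - y))\<^sup>2"
      using norm_gradient_step_sq_le[OF L L0, of x y] by linarith
  qed simp
  have minimal: "lasso_obj A b xs \<le> lasso_obj A b y" if "norm1 y \<le> \<tau>" for y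
    using sol that unfolding lasso_solution_def is_arg_min_linorder lasso_obj_def
    by (auto intro!: power_mono divide_right_mono)
  have feasible: "norm1 xs \<le> \<tau>"
    using sol by (simp add: lasso_solution_def is_arg_min_linorder)
  have fixed: "proj1 (xs - (1 / L) *\<^sub>R ?g xs) \<tau> = xs"
    by (rule proj1_gradient_step_minimizer[OF \<tau>0 L0 upper feasible minimal])
  obtain r where r: "0 < r"
    and r_support: "\<And>v. dist v (xs - (1 / L) *\<^sub>R ?g xs) < r \<Longrightarrow> support (proj1 v \<tau>) \<subseteq> support xs"
    using eventually_support_proj1_subset[OF \<tau>0 L0 fixed i0 multiplier strict]
    unfolding eventually_nhds_metric by blast
  \<comment> \<open>The maximum with \<open>1 / 2\<close> keeps \<open>\<rho>\<close> positive when
    \<open>L = 1 - \<delta>\<close>, where the root vanishes.\<close>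
  define \<rho> where "\<rho> = max (1 / 2) (sqrt (1 - (1 - \<delta>) / L))"
  have \<rho>: "0 < \<rho>" "\<rho> < 1"
    using \<delta> L0 by (auto simp: \<rho>_def real_sqrt_lt_1_iff)
  have \<rho>2: "1 - (1 - \<delta>) / L \<le> \<rho>\<^sup>2"
  proof -
    have "0 \<le> 1 - (1 - \<delta>) / L" using \<delta>L L0 by simp
    then have "1 - (1 - \<delta>) / L = (sqrt (1 - (1 - \<delta>) / L))\<^sup>2" by simp
    also have "\<dots> \<le> \<rho>\<^sup>2"
      by (intro power_mono) (use \<open>0 \<le> 1 - (1 - \<delta>) / L\<close> in \<open>auto simp: \<rho>_def\<close>)
    finally show ?thesis .
  qed
  have contract: "norm (proj1 (apg_y ?g L \<tau> c K - (1 / L) *\<^sub>R ?g (apg_y ?g L \<tau> c K)) \<tau> - xs)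
      \<le> \<rho> * norm (c - xs)" if c: "norm (c - xs) < r" for c
  proof -
    define x y where "x = apg_x ?g L \<tau> c K" and "y = apg_y ?g L \<tau> c K"
    have x: "norm (x - xs) \<le> norm (c - xs)"
      unfolding x_def by (rule norm_apg_x_diff_le[OF \<tau>0 L0 lower upper step feasible minimal])
    have y_eq: "y = proj1 (x - (1 / L) *\<^sub>R ?g x) \<tau>"
      by (simp add: y_def x_def apg_y.simps)
    have nonexp: "norm (proj1 (v - (1 / L) *\<^sub>R ?g v) \<tau> - xs)
        \<le> norm ((v - (1 / L) *\<^sub>R ?g v) - (xs - (1 / L) *\<^sub>R ?g xs))" for v
      using proj1_nonexpansive[OF \<tau>0, of "v - (1 / L) *\<^sub>R ?g v" "xs - (1 / L) *\<^sub>R ?g xs"]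
      unfolding fixed .
    have y: "norm (y - xs) \<le> norm (c - xs)"
      unfolding y_eq using order_trans[OF nonexp order_trans[OF step x]] .
    \<comment> \<open>Nonexpansiveness carries the bound on \<open>x\<close> over to the point whose
      projection is \<open>y\<close>.\<close>
    have "dist (x - (1 / L) *\<^sub>R ?g x) (xs - (1 / L) *\<^sub>R ?g xs) < r"
      using step[of x xs] x c by (simp add: dist_norm)
    then have "support y \<subseteq> support xs"
      unfolding y_eq by (rule r_support)
    then have "support (y - xs) \<subseteq> support xs"
      by (auto simp: support_def)
    then have "norm0 (y - xs) \<le> 2 * s"
      using card_mono[of "support xs" "support (y - xs)"] s by (simp add: norm0_def)
    note rip = RIP_le[OF this]
    have "(norm (proj1 (y - (1 / L) *\<^sub>R ?g y) \<tau> - xs))\<^sup>2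
        \<le> (norm ((y - (1 / L) *\<^sub>R ?g y) - (xs - (1 / L) *\<^sub>R ?g xs)))\<^sup>2"
      by (intro power_mono nonexp) simp
    also have "\<dots> \<le> (norm (y - xs))\<^sup>2 - (norm (A *v (y - xs)))\<^sup>2 / L"
      by (rule norm_gradient_step_sq_le[OF L L0])
    also have "\<dots> \<le> (norm (y - xs))\<^sup>2 - (1 - \<delta>) * (norm (y - xs))\<^sup>2 / L"
      using rip L0 by (intro diff_mono divide_right_mono) auto
    also have "\<dots> = (1 - (1 - \<delta>) / L) * (norm (y - xs))\<^sup>2"
      by (simp add: algebra_simps)
    also have "\<dots> \<le> \<rho>\<^sup>2 * (norm (c - xs))\<^sup>2"
      using \<rho>2 y by (intro mult_mono power_mono) auto
    finally have "(norm (proj1 (y - (1 / L) *\<^sub>R ?g y) \<tau> - xs))\<^sup>2 \<le> (\<rho> * norm (c - xs))\<^sup>2"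
      by (simp add: power_mult_distrib)
    then show ?thesis
      unfolding y_def by (rule power2_le_imp_le) (use \<rho> in simp)
  qed
  have "norm (nesta_lasso A b L \<tau> K p0 (Suc j) - xs) \<le> \<rho> * norm (nesta_lasso A b L \<tau> K p0 j - xs)"
    if p0: "norm (p0 - xs) < r" for p0 j
  proof -
    \<comment> \<open>As \<open>\<rho> < 1\<close>, no prox-center leaves the ball of radius
      \<open>r\<close>, so \<open>contract\<close> applies at every restart.\<close>
    have "norm (nesta_lasso A b L \<tau> K p0 j - xs) < r" for j
    proof (induction j)
      case (Suc j)
      have "\<rho> * norm (nesta_lasso A b L \<tau> K p0 j - xs) \<le> 1 * norm (nesta_lasso A b L \<tau> K p0 j - xs)"
        using \<rho> by (intro mult_right_mono) auto
      then show ?case using contract[OF Suc.IH] Suc.IH by (simp add: Let_def)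
    qed (use p0 in simp)
    from contract[OF this, of j] show ?thesis by (simp add: Let_def)
  qed
  then show ?thesis
    unfolding locally_linearly_convergent_def using r \<rho> by blast
qed

section \<open>Strict complementarity fails on a null set\<close>

text \<open>A basis vector \<open>axis i u\<close> sees only one component. Components may lie in
  any Euclidean space, so the rule covers the rows and then the entries of a matrix.\<close>

lemma differentiable_vec_lambda:
  fixes f :: "'a::real_normed_vector \<Rightarrow> 'i::finite \<Rightarrow> 'b::euclidean_space"
  assumes "\<And>i. (\<lambda>x. f x i) differentiable at x within S"
  shows "(\<lambda>x. \<chi> i. f x i) differentiable at x within S"
proof -
  have "(\<lambda>x. (\<chi> i. f x i) \<bullet> b) differentiable at x within S" if "b \<in> Basis" for b
  proof -
    obtain i u where "b = axis i u" "u \<in> Basis"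
      using \<open>b \<in> Basis\<close> by (auto simp: Basis_vec_def)
    have "(\<lambda>x. (\<chi> i. f x i) \<bullet> b) = (\<lambda>x. f x i \<bullet> u)"
      by (simp add: \<open>b = axis i u\<close> inner_axis)
    then show ?thesis
      using iffD1[OF differentiable_componentwise_within assms[of i]] \<open>u \<in> Basis\<close> by simp
  qed
  then show ?thesis
    by (subst differentiable_componentwise_within) blast
qed

text \<open>The data \<open>(A, b, \<gamma>)\<close> are parametrized by the residual \<open>r = b - A *v x\<close> instead of \<open>b\<close>.  If
  \<open>r $ k \<noteq> 0\<close>, then the \<open>k\<close>-th entries of the columns \<open>j \<in> insert i I\<close> can be solved for.  The free
  slots of the \<open>k\<close>-th row at \<open>j \<in> I\<close> carry the entries of \<open>x\<close>, and the slot at \<open>i\<close> remains unused, so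
  that the data are a differentiable image of a hyperplane.\<close>

lemma negligible_fixed_correlations:
  fixes I :: "'n::finite set" and k :: "'m::finite"
  assumes i: "i \<notin> I"
  shows "negligible {(A :: real^'n^'m, b :: real^'m, \<gamma> :: real).
    \<exists>x. support x \<subseteq> I \<and> (b - A *v x) $ k \<noteq> 0 \<and>
      (\<forall>j\<in>insert i I. (transpose A *v (b - A *v x)) $ j = \<gamma> * \<sigma> j)}"
    (is "negligible ?T")
proof -
  define matrix' where "matrix' = (\<lambda>(M :: real^'n^'m, r :: real^'m, \<gamma> :: real). (\<chi> l j.
    if l = k \<and> j \<in> insert i I then (\<gamma> * \<sigma> j - (\<Sum>l\<in>-{k}. M $ l $ j * r $ l)) / r $ k
    else M $ l $ j) :: real^'n^'m)"
  define x' where "x' = (\<lambda>(M :: real^'n^'m, r :: real^'m, \<gamma> :: real).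
    (\<chi> j. if j \<in> I then M $ k $ j else 0) :: real^'n)"
  define \<Phi> where "\<Phi> = (\<lambda>p :: (real^'n^'m) \<times> (real^'m) \<times> real.
    (matrix' p, matrix' p *v x' p + fst (snd p), snd (snd p)))"
  \<comment> \<open>The vanishing entry puts \<open>S\<close> in a hyperplane; the nonzero residual
    entry keeps the quotient in \<open>matrix'\<close> differentiable.\<close>
  define S :: "((real^'n^'m) \<times> (real^'m) \<times> real) set"
    where "S = {p. fst p $ k $ i = 0 \<and> fst (snd p) $ k \<noteq> 0}"
  have "negligible {p :: (real^'n^'m) \<times> (real^'m) \<times> real. (axis k (axis i 1), 0, 0) \<bullet> p = 0}"
    by (rule negligible_hyperplane) (simp add: axis_eq_0_iff zero_prod_def)
  then have "negligible S"
    by (rule negligible_subset) (auto simp: S_def inner_axis' inner_axis)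
  moreover have "\<Phi> differentiable_on S"
  proof -
    have nth: "(\<lambda>p. f p $ j) differentiable F" if "f differentiable F"
      for f :: "(real^'n^'m) \<times> (real^'m) \<times> real \<Rightarrow> ('c::real_normed_vector)^'d" and j F
      using that bounded_linear.has_derivative[OF bounded_linear_vec_nth]
      unfolding differentiable_def by blast
    have fst: "fst differentiable F" and snd: "snd differentiable F"
      for F :: "('c::real_normed_vector \<times> 'd::real_normed_vector) filter"
      unfolding differentiable_def
      using bounded_linear_imp_has_derivative bounded_linear_fst bounded_linear_snd by blast+
    have snd': "(\<lambda>p. fst (snd p)) differentiable F" "(\<lambda>p. snd (snd p)) differentiable F"
      for F :: "('c::real_normed_vector \<times> 'd::real_normed_vector \<times> 'e::real_normed_vector) filter"
      unfolding differentiable_def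
      using bounded_linear_compose[OF bounded_linear_fst bounded_linear_snd]
        bounded_linear_compose[OF bounded_linear_snd bounded_linear_snd]
        bounded_linear_imp_has_derivative by blast+
    have matrix': "matrix' differentiable at p within S" if "p \<in> S" for p
    proof -
      have "(\<lambda>p :: (real^'n^'m) \<times> (real^'m) \<times> real. if l = k \<and> j \<in> insert i I
          then (snd (snd p) * \<sigma> j - (\<Sum>l\<in>-{k}. fst p $ l $ j * fst (snd p) $ l)) / fst (snd p) $ k
          else fst p $ l $ j) differentiable at p within S" for l j
        using that
        by (cases "l = k \<and> j \<in> insert i I")
          (auto simp: S_def intro!: differentiable_divide differentiable_diff differentiable_mult
            differentiable_sum nth fst snd')
      then show ?thesis
        unfolding matrix'_def case_prod_unfold by (intro differentiable_vec_lambda)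
    qed
    have x': "x' differentiable at p within S" for p
    proof -
      have "(\<lambda>p :: (real^'n^'m) \<times> (real^'m) \<times> real. if j \<in> I then fst p $ k $ j else 0)
          differentiable at p within S" for j
        by (cases "j \<in> I") (auto intro!: nth fst)
      then show ?thesis
        unfolding x'_def case_prod_unfold by (intro differentiable_vec_lambda)
    qed
    have "(\<lambda>p. matrix' p *v x' p) differentiable at p within S" if "p \<in> S" for p
      unfolding matrix_vector_mult_def
      by (intro differentiable_vec_lambda differentiable_sum ballI differentiable_mult nth
          matrix' x' that) simp
    then show ?thesis
      unfolding differentiable_on_def \<Phi>_def
      by (intro ballI differentiable_Pair differentiable_add matrix' snd')
  qed
  \<comment> \<open>\<open>\<Phi>\<close> maps a space to itself, so the dimension condition
    holds.\<close>
  ultimately have "negligible (\<Phi> ` S)"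
    by (intro negligible_differentiable_image_negligible) auto
  moreover have "?T \<subseteq> \<Phi> ` S"
  proof clarify
    fix A :: "real^'n^'m" and b \<gamma> x
    assume x: "support x \<subseteq> I" and k: "(b - A *v x) $ k \<noteq> 0"
      and eq: "\<forall>j\<in>insert i I. (transpose A *v (b - A *v x)) $ j = \<gamma> * \<sigma> j"
    define r where "r = b - A *v x"
    \<comment> \<open>The preimage: row \<open>k\<close> stores \<open>x\<close> on \<open>I\<close>
      and zero at \<open>i\<close>, and all other entries are those of \<open>A\<close>.\<close>
    define M :: "real^'n^'m" where
      "M = (\<chi> l j. if l = k \<and> j \<in> I then x $ j else if l = k \<and> j = i then 0 else A $ l $ j)"
    have "A $ k $ j = (\<gamma> * \<sigma> j - (\<Sum>l\<in>-{k}. A $ l $ j * r $ l)) / r $ k" if "j \<in> insert i I" for j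
    proof -
      have "\<gamma> * \<sigma> j = (transpose A *v r) $ j"
        using bspec[OF eq that] by (simp add: r_def)
      also have "\<dots> = (\<Sum>l\<in>UNIV. A $ l $ j * r $ l)"
        by (simp add: matrix_vector_mult_def transpose_def del: transpose_matrix_vector)
      also have "\<dots> = A $ k $ j * r $ k + (\<Sum>l\<in>-{k}. A $ l $ j * r $ l)"
        by (simp add: sum.remove[of UNIV k] Compl_eq_Diff_UNIV)
      finally show ?thesis using k by (simp add: r_def)
    qed
    \<comment> \<open>The sum skips row \<open>k\<close>, the only one where \<open>M\<close> may
      differ from \<open>A\<close>, so the overwritten entries are recoverable.\<close>
    moreover have "(\<Sum>l\<in>-{k}. M $ l $ j * r $ l) = (\<Sum>l\<in>-{k}. A $ l $ j * r $ l)" for j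
      by (intro sum.cong) (auto simp: M_def)
    moreover have "M $ l $ j = A $ l $ j" if "\<not> (l = k \<and> j \<in> insert i I)" for l j
      using that by (auto simp: M_def)
    ultimately have "matrix' (M, r, \<gamma>) = A"
      by (simp add: matrix'_def vec_eq_iff)
    moreover have "x' (M, r, \<gamma>) = x"
      using x by (auto simp: x'_def M_def vec_eq_iff support_def)
    ultimately have "(A, b, \<gamma>) = \<Phi> (M, r, \<gamma>)"
      by (simp add: \<Phi>_def r_def)
    moreover have "(M, r, \<gamma>) \<in> S"
      using i k by (simp add: S_def M_def r_def)
    ultimately show "(A, b, \<gamma>) \<in> \<Phi> ` S" by blast
  qed
  ultimately show ?thesis by (rule negligible_subset)
qed

text \<open>Off the hyperplane \<open>\<gamma> = 0\<close>, a failure at \<open>i\<close> means that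
  all columns in \<open>insert i I\<close> have correlation \<open>\<gamma>\<close> or
  \<open>-\<gamma>\<close> with a nonzero residual. Only finitely many choices of \<open>i\<close>,
  of the residual entry \<open>k\<close> and of the signs exist.\<close>

lemma negligible_not_strictly_complementary:
  fixes I :: "'n::finite set"
  assumes "I \<noteq> {}"
  shows "negligible {(A :: real^'n^'m, b :: real^'m, \<gamma> :: real). 0 \<le> \<gamma> \<and>
    (\<exists>x. support x = I \<and> lasso_multiplier A b \<gamma> x \<and>
      (\<exists>i. i \<notin> I \<and> \<gamma> \<le> \<bar>(transpose A *v (b - A *v x)) $ i\<bar>))}"
    (is "negligible ?N")
proof -
  \<comment> \<open>A sign pattern is encoded by the set \<open>J\<close> of its positive
    coordinates, so the patterns form a finite family.\<close>
  define \<sigma> where "\<sigma> J j = (if j \<in> J then 1 else - 1 :: real)" for J :: "'n set" and j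
  define T where "T i k J = {(A :: real^'n^'m, b :: real^'m, \<gamma> :: real).
    \<exists>x. support x \<subseteq> I \<and> (b - A *v x) $ k \<noteq> 0 \<and>
      (\<forall>j\<in>insert i I. (transpose A *v (b - A *v x)) $ j = \<gamma> * \<sigma> J j)}" for i k J
  define Z where "Z = {p :: (real^'n^'m) \<times> (real^'m) \<times> real. (0, 0, 1) \<bullet> p = 0}"
  have "negligible Z"
    unfolding Z_def by (rule negligible_hyperplane) (simp add: zero_prod_def)
  moreover have "negligible (\<Union>i\<in>-I. \<Union>k. \<Union>J. T i k J)"
  proof -
    have "negligible (T i k J)" if "i \<in> - I" for i k J
      unfolding T_def using that by (intro negligible_fixed_correlations) simp
    then show ?thesis
      by (auto intro!: negligible_Union)
  qed
  ultimately have "negligible (Z \<union> (\<Union>i\<in>-I. \<Union>k. \<Union>J. T i k J))"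
    by (rule negligible_Un)
  moreover have "?N \<subseteq> Z \<union> (\<Union>i\<in>-I. \<Union>k. \<Union>J. T i k J)"
  proof clarify
    fix A :: "real^'n^'m" and b \<gamma> x i
    let ?c = "transpose A *v (b - A *v x)"
    assume \<gamma>: "0 \<le> \<gamma>" and I: "I = support x" and mult: "lasso_multiplier A b \<gamma> x"
      and i: "i \<notin> support x" "\<gamma> \<le> \<bar>?c $ i\<bar>"
      and notin: "(A, b, \<gamma>) \<notin> (\<Union>i\<in>- support x. \<Union>k. \<Union>J. T i k J)"
    show "(A, b, \<gamma>) \<in> Z"
    proof (rule ccontr)
      assume "(A, b, \<gamma>) \<notin> Z"
      then have "\<gamma> \<noteq> 0" by (auto simp: Z_def)
      obtain i0 where i0: "i0 \<in> support x" using assms I by blast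
      have on: "?c $ j = \<gamma> * sgn (x $ j)" if "j \<in> support x" for j
        using mult that by (simp add: lasso_multiplier_def)
      \<comment> \<open>The correlation at \<open>i0\<close> has absolute value
        \<open>\<gamma>\<close>, so the residual cannot vanish; this supplies the row
        \<open>k\<close>.\<close>
      have "?c $ i0 \<noteq> 0"
        using on[OF i0] i0 \<open>\<gamma> \<noteq> 0\<close> by (simp add: support_def sgn_zero_iff)
      then have "b - A *v x \<noteq> 0" by auto
      then obtain k where k: "(b - A *v x) $ k \<noteq> 0" by (auto simp: vec_eq_iff)
      \<comment> \<open>The multiplier condition bounds the correlation from above, the failure of
        strictness from below.\<close>
      have off: "\<bar>?c $ i\<bar> = \<gamma>"
        using mult i by (auto simp: lasso_multiplier_def intro: antisym)
      define J where "J = {j. 0 < ?c $ j}"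
      have "?c $ j = \<gamma> * \<sigma> J j" if "j \<in> insert i (support x)" for j
      proof -
        have "\<bar>?c $ j\<bar> = \<gamma>"
          using that off on[of j] \<gamma> by (auto simp: abs_mult support_def abs_sgn_eq)
        then show ?thesis by (auto simp: \<sigma>_def J_def)
      qed
      then have "(A, b, \<gamma>) \<in> T i k J"
        using k I unfolding T_def by blast
      then show False using notin i(1) by blast
    qed
  qed
  ultimately show ?thesis by (rule negligible_subset)
qed

theorem corollary1:
  fixes s :: nat
  assumes "s \<ge> 1"
  shows "almost_always s
    (\<lambda>(A :: real^'n^'m) b \<tau> xs.
       \<forall>\<delta>2s \<delta> L (K :: nat).
         RIP A (2 * s) \<delta>2s \<longrightarrow> \<delta> = 1 - \<delta>2s \<longrightarrow>
         L = lipschitz_const (lasso_grad A b) \<longrightarrow>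
         real K > sqrt (L / \<delta>) \<longrightarrow>
         locally_linearly_convergent (nesta_lasso A b L \<tau> K) xs)"
  unfolding almost_always_def
proof (intro allI impI, elim conjE)
  fix I :: "'n set"
  assume I: "card I = s"
  with assms have "I \<noteq> {}" by auto
  note null = negligible_not_strictly_complementary[OF this, where ?'m = 'm]
  show "{(A :: real^'n^'m, b, \<gamma>). 0 \<le> \<gamma> \<and> (\<exists>\<delta>. RIP A (2 * s) \<delta>) \<and>
      (\<exists>\<tau> xs. 0 < \<tau> \<and> lasso_solution A b \<tau> xs \<and> support xs = I \<and> lasso_multiplier A b \<gamma> xs \<and>
        \<not> (\<forall>\<delta>2s \<delta> L (K :: nat).
             RIP A (2 * s) \<delta>2s \<longrightarrow> \<delta> = 1 - \<delta>2s \<longrightarrow>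
             L = lipschitz_const (lasso_grad A b) \<longrightarrow>
             real K > sqrt (L / \<delta>) \<longrightarrow>
             locally_linearly_convergent (nesta_lasso A b L \<tau> K) xs))}
    \<in> null_sets lebesgue"
    unfolding negligible_iff_null_sets[symmetric]
  proof (rule negligible_subset[OF null], clarify)
    fix A :: "real^'n^'m" and b \<gamma> \<tau> xs \<delta>2s and K :: nat
    assume *: "0 < \<tau>" "lasso_solution A b \<tau> xs" "I = support xs" "lasso_multiplier A b \<gamma> xs"
      "RIP A (2 * s) \<delta>2s"
      and fails: "\<not> locally_linearly_convergent
        (nesta_lasso A b (lipschitz_const (lasso_grad A b)) \<tau> K) xs"
    \<comment> \<open>By contraposition: under strict complementarity the tuple would satisfy the
      convergence claim.\<close>
    have "\<exists>i. i \<notin> support xs \<and> \<gamma> \<le> \<bar>(transpose A *v (b - A *v xs)) $ i\<bar>"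
    proof (rule ccontr)
      assume "\<not> ?thesis"
      then have "locally_linearly_convergent
          (nesta_lasso A b (lipschitz_const (lasso_grad A b)) \<tau> K) xs"
        using * I assms
        by (intro nesta_lasso_locally_linearly_convergent[where s = s and \<gamma> = \<gamma> and \<delta> = \<delta>2s])
          (auto simp: not_le)
      with fails show False ..
    qed
    then show "\<exists>x. support x = support xs \<and> lasso_multiplier A b \<gamma> x \<and>
        (\<exists>i. i \<notin> support xs \<and> \<gamma> \<le> \<bar>(transpose A *v (b - A *v x)) $ i\<bar>)"
      using * by blast
  qed
qed

end
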